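(* For all $X\in\mathbb R^{n\times p}$ and all $g\in\mathbb R^{n\times p}$, $$\langle\mathrm{skew}(gX^\top)X,\ X(X^\top X-I_p)\rangle=0,$$ i.e. $\langle\mathrm{grad}(g),\nabla\mathcal N(X)\rangle=0$, where $\mathrm{grad}(g):=\mathrm{skew}(gX^\top)X$ and $\nabla\mathcal N(X)=X(X^\top X-I_p)$.
   Context: $n\ge p\ge1$ are integers, $\langle A,B\rangle=\mathrm{Tr}(A^\top B)$, and $\mathrm{skew}(M)=\frac12(M-M^\top)$ for square $M$. *)

theory Defs
  imports "HOL-Analysis.Analysis"
begin

text \<open>An \<open>n \<times> p\<close> matrix has type \<open>real ^ 'p ^ 'n\<close>: the row index is the outer one.\<close>

definition frob_inner :: "real ^ 'p ^ 'n \<Rightarrow> real ^ 'p ^ 'n \<Rightarrow> real" where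
  "frob_inner A B = trace (transpose A ** B)"

definition skew :: "real ^ 'n ^ 'n \<Rightarrow> real ^ 'n ^ 'n" where
  "skew M = (1 / 2) *\<^sub>R (M - transpose M)"

definition grad_at :: "real ^ 'p ^ 'n \<Rightarrow> real ^ 'p ^ 'n \<Rightarrow> real ^ 'p ^ 'n" where
  "grad_at X g = skew (g ** transpose X) ** X"

text \<open>\<open>nabla_N X\<close> is the field written \<open>\<nabla>\<N>(X)\<close>. It is given by its closed formula; no
  potential \<open>\<N>\<close> is involved.\<close>

definition nabla_N :: "real ^ 'p ^ 'n \<Rightarrow> real ^ 'p ^ 'n" where
  "nabla_N X = X ** (transpose X ** X - mat 1)"

end

theory Submission
  imports Defs
begin

text \<open>The inner product equals the trace of \<open>S\<^sup>T (X (X\<^sup>T X - I) X\<^sup>T)\<close> with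
  \<open>S = skew (g X\<^sup>T)\<close>, a product of a skew-symmetric and a symmetric matrix, and the
  trace of such a product is its own negative.\<close>

lemma trace_transpose: "trace (transpose A) = trace (A :: 'a::semiring_1^'n^'n)"
  by (simp add: trace_def transpose_def)

lemma transpose_diff: "transpose (A - B) = transpose A - transpose (B :: 'a::ab_group_add^'n^'m)"
  by (simp add: transpose_def vec_eq_iff)

lemma transpose_skew: "transpose (skew M) = - skew M"
  by (simp add: skew_def transpose_def vec_eq_iff field_simps)

text \<open>Transposition preserves the trace and turns \<open>A ** B\<close> into
  \<open>B ** (- A)\<close>; cyclicity then leads back to \<open>- trace (A ** B)\<close>.\<close>

lemma trace_skew_symmetric_mult_symmetric:
  fixes A B :: "real^'n^'n"
  assumes "transpose A = - A" and "transpose B = B"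
  shows "trace (A ** B) = 0"
proof -
  have "trace (A ** B) = trace (B ** (- A))"
    using assms trace_transpose[of "A ** B"] by (simp add: matrix_transpose_mul)
  also have "\<dots> = - trace (B ** A)"
    by (simp add: trace_def matrix_matrix_mult_def sum_negf)
  also have "\<dots> = - trace (A ** B)"
    by (simp only: trace_mul_sym[of B A])
  finally show ?thesis by simp
qed

text \<open>Orthogonality rests on symmetry types alone, so \<open>N\<close> abstracts
  \<open>transpose X ** X - mat 1\<close>.\<close>

lemma frob_inner_skew_mult:
  fixes S :: "real^'n^'n" and X :: "real^'p^'n" and N :: "real^'p^'p"
  assumes S: "transpose S = - S" and N: "transpose N = N"
  shows "frob_inner (S ** X) (X ** N) = 0"
proof -
  have "frob_inner (S ** X) (X ** N) = trace (transpose X ** (transpose S ** (X ** N)))"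
    by (simp add: frob_inner_def matrix_transpose_mul matrix_mul_assoc)
  \<comment> \<open>Cyclicity moves the leading \<open>transpose X\<close> to the right end,
    completing a congruence of \<open>N\<close>, which inherits its symmetry.\<close>
  also have "\<dots> = trace (transpose S ** (X ** N ** transpose X))"
    by (subst trace_mul_sym[of "transpose X"]) (simp add: matrix_mul_assoc)
  also have "\<dots> = 0"
  proof (rule trace_skew_symmetric_mult_symmetric)
    show "transpose (transpose S) = - transpose S"
      using S by (metis minus_minus transpose_transpose)
    show "transpose (X ** N ** transpose X) = X ** N ** transpose X"
      by (simp add: N matrix_transpose_mul matrix_mul_assoc)
  qed
  finally show ?thesis .
qed

theorem proposition4p1:
  fixes X g :: "real ^ 'p ^ 'n"
  assumes "CARD('p) \<le> CARD('n)"
  shows "frob_inner (skew (g ** transpose X) ** X) (X ** (transpose X ** X - mat 1)) = 0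
    \<and> frob_inner (grad_at X g) (nabla_N X) = 0"
proof -
  \<comment> \<open>A Gram matrix minus the identity is symmetric and serves as \<open>N\<close>,
    with \<open>skew (g ** transpose X)\<close> as \<open>S\<close>; once unfolded, both conjuncts
    are this one instance.\<close>
  have "transpose (transpose X ** X - mat 1) = transpose X ** X - mat 1"
    by (simp add: transpose_diff matrix_transpose_mul transpose_mat)
  then show ?thesis
    by (simp add: grad_at_def nabla_N_def frob_inner_skew_mult transpose_skew)
qed

end
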